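(* Let $B=5$, let $\tilde p>0$ be an integer and $\tilde q$ a positive integer with $\tilde q\geqslant 3600\sqrt[3]{|\tilde p|}$. Let $F_2=B^{2}\tilde q^{6}-2B\tilde q^{4}-2B\tilde p\tilde q^{3}-2\tilde q^{2}+2\tilde p\tilde q+\tilde p^{2}-\frac5B-\frac{20}{B^{2}\tilde q^{2}}$. Then there is no integer $t$ with $F_2-\frac{10\tilde p}{B^{2}\tilde q^{3}}<t<F_2$. *)

theory Defs
  imports Complex_Main
begin

definition F2 :: "real \<Rightarrow> real \<Rightarrow> real \<Rightarrow> real" where
  "F2 B p q = B^2 * q^6 - 2 * B * q^4 - 2 * B * p * q^3 - 2 * q^2 + 2 * p * q + p^2
     - 5 / B - 20 / (B^2 * q^2)"

end

theory Submission
  imports Defs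
begin

text \<open>For \<open>B = 5\<close> every term of \<open>F2\<close> except the last is an integer, so \<open>F2\<close> lies
  \<open>4 / (5 q\<^sup>2) < 1\<close> below an integer \<open>N\<close>. Since \<open>2 p \<le> q\<^sup>3\<close>, the interval in question
  is contained in the gap between \<open>N - 1\<close> and \<open>N\<close>.\<close>

theorem theorem7p6:
  fixes B :: real and p q :: int
  assumes "B = 5"
    and "p > 0"
    and "q > 0"
    and "real_of_int q \<ge> 3600 * root 3 \<bar>real_of_int p\<bar>"
  shows "\<not> (\<exists>t::int. F2 B (real_of_int p) (real_of_int q)
                 - 10 * real_of_int p / (B^2 * (real_of_int q)^3) < real_of_int t
               \<and> real_of_int t < F2 B (real_of_int p) (real_of_int q))"
proof
  define P Q where "P = real_of_int p" and "Q = real_of_int q"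
  define N where "N = 25*q^6 - 10*q^4 - 10*p*q^3 - 2*q^2 + 2*p*q + p^2 - 1"
  have pos: "P > 0" "Q \<ge> 1"
    using assms by (auto simp: P_def Q_def)
  have F2_eq: "F2 B P Q = real_of_int N - 4 / (5 * Q^2)"
    by (simp add: F2_def N_def P_def Q_def \<open>B = 5\<close>)
  \<comment> \<open>Cubing removes the root and gives \<open>3600^3 * P \<le> Q^3\<close>. The
    factor 2 kept below is the one in
    \<open>10 * P / (25 * Q^3) = (2 * P / Q^3) / 5\<close>.\<close>
  have "(3600 * root 3 P) ^ 3 \<le> Q ^ 3"
    using assms pos by (intro power_mono) (auto simp: P_def Q_def)
  then have "2 * P \<le> Q ^ 3"
    using pos by (simp add: power_mult_distrib)
  then have small1: "10 * P / (B^2 * Q^3) \<le> 1/5"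
    using pos by (simp add: \<open>B = 5\<close> divide_simps)
  have "Q^2 \<ge> 1"
    using pos by simp
  then have small2: "4 / (5 * Q^2) \<le> 4/5" "4 / (5 * Q^2) > 0"
    by (auto simp: divide_simps)
  assume "\<exists>t::int. F2 B (real_of_int p) (real_of_int q)
                 - 10 * real_of_int p / (B^2 * (real_of_int q)^3) < real_of_int t
               \<and> real_of_int t < F2 B (real_of_int p) (real_of_int q)"
  then obtain t :: int where "F2 B P Q - 10 * P / (B^2 * Q^3) < real_of_int t"
      and "real_of_int t < F2 B P Q"
    by (auto simp: P_def Q_def)
  \<comment> \<open>The bounds 1/5 and 4/5 add up to exactly 1, so the left end of the interval is
    at least \<open>N - 1\<close>; the strict inequality for \<open>t\<close> excludes
    \<open>t = N - 1\<close>. The right end is below \<open>N\<close> since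
    \<open>4 / (5 * Q^2) > 0\<close>.\<close>
  then have "real_of_int (N - 1) < real_of_int t" "real_of_int t < real_of_int N"
    using small1 small2 F2_eq unfolding of_int_diff of_int_1 by linarith+
  then show False
    unfolding of_int_less_iff by linarith
qed

end
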